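(* For every integer $n\ge 1$, $$ DSOME(n)=\sum_{\substack{1\le j\le n\\ j\ \mathrm{odd}}}p_d(n-j)\,\sigma(j)-3\sum_{\substack{1\le j\le n\\ j\ \mathrm{even}}}p_d(n-j)\,\sigma\!\left(\frac{j}{2^{\nu_2(j)}}\right). $$
   Context: $DSOME(n)$ is the sum of all odd parts minus the sum of all even parts, taken over all partitions of $n$ into distinct parts. $p_d(n)$ is the number of partitions of $n$ into distinct parts, with $p_d(0)=1$. $\sigma(n)=\sum_{d\mid n}d$ is the sum-of-divisors function. For a positive integer $j$, $\nu_2(j)$ is the non-negative integer such that $j=2^{\nu_2(j)}u$ with $u$ odd (so $\nu_2(j)\ge1$ when $j$ is even). *)

theory Defs
  imports
    "HOL-Library.Multiset"
    "HOL-Computational_Algebra.Primes"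
begin

definition partitions :: "nat \<Rightarrow> nat multiset set" where
  "partitions n = {P. 0 \<notin># P \<and> sum_mset P = n}"

definition distinct_partitions :: "nat \<Rightarrow> nat multiset set" where
  "distinct_partitions n = {P \<in> partitions n. \<forall>i. count P i \<le> 1}"

text \<open>Finiteness guarantees that the \<open>card\<close> and the sum over \<open>distinct_partitions n\<close>
  below have their intended meaning.\<close>

lemma finite_distinct_partitions: "finite (distinct_partitions n)"
proof (rule finite_subset)
  show "distinct_partitions n \<subseteq> mset_set ` Pow {..n}"
  proof
    fix P assume P: "P \<in> distinct_partitions n"
    then have sum: "sum_mset P = n" and c: "\<And>i. count P i \<le> 1"
      by (auto simp: distinct_partitions_def partitions_def)
    have "P = mset_set (set_mset P)"
    proof (rule multiset_eqI)
      fix i show "count P i = count (mset_set (set_mset P)) i"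
        using c[of i] by (cases "i \<in># P")
          (auto simp: count_mset_set' not_in_iff le_Suc_eq simp flip: count_greater_zero_iff)
    qed
    moreover have "set_mset P \<subseteq> {..n}"
      using sum by (auto dest!: multi_member_split)
    ultimately show "P \<in> mset_set ` Pow {..n}" by blast
  qed
qed simp

definition p_d :: "nat \<Rightarrow> nat" where
  "p_d n = card (distinct_partitions n)"

lemma p_d_0: "p_d 0 = 1"
proof -
  have "distinct_partitions 0 = {{#}}"
  proof (intro set_eqI iffI)
    fix P :: "nat multiset"
    assume "P \<in> distinct_partitions 0"
    then show "P \<in> {{#}}"
      by (cases P) (auto simp: distinct_partitions_def partitions_def)
  qed (simp add: distinct_partitions_def partitions_def)
  then show ?thesis by (simp add: p_d_def)
qed

definition DSOME :: "nat \<Rightarrow> int" where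
  "DSOME n = (\<Sum>P\<in>distinct_partitions n.
     int (sum_mset (filter_mset odd P)) - int (sum_mset (filter_mset even P)))"

definition sigma :: "nat \<Rightarrow> nat" where
  "sigma n = (\<Sum>d | d dvd n. d)"

end

theory Submission
  imports Defs
begin

text \<open>
  A distinct partition of \<open>m\<close> containing the part \<open>k\<close> is a distinct partition of \<open>m - k\<close>
  not containing \<open>k\<close>. Iterating, the number of distinct partitions of \<open>m\<close> containing \<open>k\<close> is
  \<open>p\<^sub>d(m - k) - p\<^sub>d(m - 2k) + p\<^sub>d(m - 3k) - \<dots>\<close>. Exchanging sums in \<open>DSOME\<close> leaves
  \<open>\<Sum>\<^sub>j p\<^sub>d(n - j) c(j)\<close>, where \<open>c(j)\<close> is the sum of \<open>\<plusminus>d (-1)^(j/d - 1)\<close> over the divisors \<open>d\<close>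
  of \<open>j\<close>, with sign \<open>+\<close> for odd and \<open>-\<close> for even \<open>d\<close>. For even \<open>j\<close>, splitting the divisors by
  parity evaluates \<open>c(j)\<close> to \<open>-3\<close> times the divisor sum of the odd part of \<open>j\<close>.
\<close>

lemma count_distinct_partition:
  assumes "P \<in> distinct_partitions n"
  shows "count P i = (if i \<in># P then 1 else 0)"
proof -
  have "count P i \<le> 1"
    using assms by (simp add: distinct_partitions_def)
  moreover have "count P i = 0 \<longleftrightarrow> i \<notin># P"
    by (rule count_eq_zero_iff)
  ultimately show ?thesis by presburger
qed

lemma distinct_partition_part_bounds:
  assumes "P \<in> distinct_partitions n" "k \<in># P"
  shows "1 \<le> k" "k \<le> n"
proof -
  have "0 \<notin># P" "sum_mset P = n"
    using assms by (auto simp: distinct_partitions_def partitions_def)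
  with assms(2) show "1 \<le> k" "k \<le> n"
    by (auto simp: Suc_le_eq dest!: multi_member_split intro: gr0I)
qed

definition count_with_part :: "nat \<Rightarrow> nat \<Rightarrow> nat" where
  "count_with_part k m = card {P \<in> distinct_partitions m. k \<in># P}"

lemma count_with_part_eq_0:
  assumes "m < k"
  shows "count_with_part k m = 0"
proof -
  have "{P \<in> distinct_partitions m. k \<in># P} = {}"
    using assms distinct_partition_part_bounds(2) by fastforce
  then show ?thesis unfolding count_with_part_def by (simp only: card.empty)
qed

text \<open>Deleting the part \<open>k\<close> is a bijection onto the distinct partitions of
  \<open>m - k\<close> that avoid \<open>k\<close>; those that contain \<open>k\<close> make up the
  rest of \<open>p_d (m - k)\<close>. Stated additively to stay clear of truncated
  subtraction.\<close>

lemma count_with_part_rec: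
  assumes "1 \<le> k" "k \<le> m"
  shows "count_with_part k m + count_with_part k (m - k) = p_d (m - k)"
proof -
  let ?A = "{P \<in> distinct_partitions m. k \<in># P}"
  let ?B = "{P \<in> distinct_partitions (m - k). k \<notin># P}"
  let ?C = "{P \<in> distinct_partitions (m - k). k \<in># P}"
  have "bij_betw (\<lambda>P. P - {#k#}) ?A ?B"
  proof (rule bij_betw_byWitness[where f' = "add_mset k"])
    show "(\<lambda>P. P - {#k#}) ` ?A \<subseteq> ?B"
    proof
      fix Q assume "Q \<in> (\<lambda>P. P - {#k#}) ` ?A"
      then obtain P where P: "P \<in> distinct_partitions m" "k \<in># P" "Q = P - {#k#}"
        by auto
      then have PQ: "P = add_mset k Q" by simp
      have "count Q i \<le> 1" for i
        using count_distinct_partition[OF P(1), of i] by (simp add: P(3) split: if_splits)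
      moreover have "count Q k = 0"
        using count_distinct_partition[OF P(1), of k] P(2) by (simp add: P(3))
      ultimately show "Q \<in> ?B"
        using P(1) unfolding PQ
        by (auto simp: distinct_partitions_def partitions_def count_eq_zero_iff)
    qed
    show "add_mset k ` ?B \<subseteq> ?A"
      using assms by (auto simp: distinct_partitions_def partitions_def not_in_iff)
  qed auto
  then have "count_with_part k m = card ?B"
    unfolding count_with_part_def by (rule bij_betw_same_card)
  moreover have "card (?B \<union> ?C) = card ?B + card ?C"
    by (rule card_Un_disjoint) (auto simp: finite_distinct_partitions)
  moreover have "?B \<union> ?C = distinct_partitions (m - k)"
    by auto
  ultimately show ?thesis
    by (simp add: count_with_part_def p_d_def)
qed

text \<open>Unrolls the recurrence. Indexing by the multiples \<open>j\<close> of \<open>k\<close>,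
  not by \<open>j div k\<close>, prepares the exchange of the sums over \<open>k\<close> and
  \<open>j\<close>. The exponent \<open>Suc (j div k)\<close> has the parity of
  \<open>j div k - 1\<close>.\<close>

lemma count_with_part_closed_form:
  assumes "1 \<le> k"
  shows "int (count_with_part k m) =
    (\<Sum>j | j \<in> {1..m} \<and> k dvd j. (-1) ^ Suc (j div k) * int (p_d (m - j)))"
proof (induction m rule: less_induct)
  case (less m)
  show ?case
  proof (cases "k \<le> m")
    case False
    then have "{j. j \<in> {1..m} \<and> k dvd j} = {}"
      by (auto dest: dvd_imp_le)
    then have "(\<Sum>j | j \<in> {1..m} \<and> k dvd j. (-1) ^ Suc (j div k) * int (p_d (m - j))) = 0"
      by (simp only: sum.empty)
    then show ?thesis
      using False by (simp only: count_with_part_eq_0 not_le of_nat_0)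
  next
    case True
    let ?J = "{j. j \<in> {1..m - k} \<and> k dvd j}"
    \<comment> \<open>The term \<open>j = k\<close> has sign +1; shifting the other multiples by
      \<open>k\<close> raises the quotient by one and flips their sign.\<close>
    have J: "{j. j \<in> {1..m} \<and> k dvd j} = insert k ((+) k ` ?J)"
    proof (intro set_eqI iffI)
      fix j assume j: "j \<in> {j. j \<in> {1..m} \<and> k dvd j}"
      then have "k \<le> j" by (auto dest: dvd_imp_le)
      then have "j = k \<or> j = k + (j - k) \<and> j - k \<in> ?J"
        using j by (auto simp: dvd_diff_nat)
      then show "j \<in> insert k ((+) k ` ?J)" by blast
    qed (use assms True in auto)
    have "(\<Sum>j | j \<in> {1..m} \<and> k dvd j. (-1) ^ Suc (j div k) * int (p_d (m - j)))
      = int (p_d (m - k)) + (\<Sum>j\<in>?J. (-1) ^ Suc ((k + j) div k) * int (p_d (m - (k + j))))"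
      unfolding J using assms by (subst sum.insert) (auto simp: sum.reindex)
    also have "\<dots> = int (p_d (m - k)) - (\<Sum>j\<in>?J. (-1) ^ Suc (j div k) * int (p_d (m - k - j)))"
      using assms by (simp add: sum_negf)
    also have "\<dots> = int (p_d (m - k)) - int (count_with_part k (m - k))"
      using less[of "m - k"] assms True by simp
    also have "\<dots> = int (count_with_part k m)"
      using count_with_part_rec[OF assms True] by simp
    finally show ?thesis by simp
  qed
qed

definition parity_weight :: "nat \<Rightarrow> int" where
  "parity_weight k = (if odd k then int k else - int k)"

text \<open>The coefficient c(j) of \<open>p_d (n - j)\<close> in \<open>DSOME n\<close>.\<close>

definition signed_divisor_sum :: "nat \<Rightarrow> int" where
  "signed_divisor_sum j = (\<Sum>d | d dvd j. parity_weight d * (-1) ^ Suc (j div d))"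

lemma parity_weight_sum_mset:
  "int (sum_mset (filter_mset odd P)) - int (sum_mset (filter_mset even P))
    = (\<Sum>k\<in>#P. parity_weight k)"
  by (induction P) (auto simp: parity_weight_def)

lemma sum_mset_distinct_partition:
  fixes f :: "nat \<Rightarrow> int"
  assumes "P \<in> distinct_partitions n"
  shows "(\<Sum>k\<in>#P. f k) = (\<Sum>k | k \<in> {1..n} \<and> k \<in># P. f k)"
proof -
  have "P = mset_set (set_mset P)"
    by (rule multiset_eqI) (simp add: count_distinct_partition[OF assms] count_mset_set')
  then have "(\<Sum>k\<in>#P. f k) = (\<Sum>k\<in>set_mset P. f k)"
    by (metis sum_unfold_sum_mset)
  also have "set_mset P = {k. k \<in> {1..n} \<and> k \<in># P}"
    using distinct_partition_part_bounds[OF assms] by auto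
  finally show ?thesis .
qed

text \<open>Double counting of the pairs of a distinct partition and one of its parts.\<close>

lemma DSOME_eq_sum_parts:
  "DSOME n = (\<Sum>k\<in>{1..n}. parity_weight k * int (count_with_part k n))"
proof -
  have "DSOME n = (\<Sum>P\<in>distinct_partitions n. \<Sum>k | k \<in> {1..n} \<and> k \<in># P. parity_weight k)"
    unfolding DSOME_def parity_weight_sum_mset
    by (intro sum.cong refl sum_mset_distinct_partition)
  also have "\<dots> = (\<Sum>k\<in>{1..n}. \<Sum>P | P \<in> distinct_partitions n \<and> k \<in># P. parity_weight k)"
    by (rule sum.swap_restrict) (simp_all add: finite_distinct_partitions)
  finally show ?thesis
    by (simp add: count_with_part_def mult.commute)
qed

lemma DSOME_eq_convolution:
  "DSOME n = (\<Sum>j\<in>{1..n}. int (p_d (n - j)) * signed_divisor_sum j)"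
proof -
  have "DSOME n = (\<Sum>k\<in>{1..n}. \<Sum>j | j \<in> {1..n} \<and> k dvd j.
      parity_weight k * ((-1) ^ Suc (j div k) * int (p_d (n - j))))"
    unfolding DSOME_eq_sum_parts
    by (intro sum.cong refl) (simp add: count_with_part_closed_form sum_distrib_left)
  also have "\<dots> = (\<Sum>j\<in>{1..n}. \<Sum>k | k \<in> {1..n} \<and> k dvd j.
      parity_weight k * ((-1) ^ Suc (j div k) * int (p_d (n - j))))"
    by (rule sum.swap_restrict) simp_all
  also have "\<dots> = (\<Sum>j\<in>{1..n}. int (p_d (n - j)) * signed_divisor_sum j)"
  proof (rule sum.cong[OF refl])
    fix j assume j: "j \<in> {1..n}"
    \<comment> \<open>Divisors of a positive \<open>j\<close> \<le> \<open>n\<close> lie in the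
      range automatically.\<close>
    then have "{k. k \<in> {1..n} \<and> k dvd j} = {k. k dvd j}"
      by (auto simp: Suc_le_eq intro: gr0I dest: dvd_imp_le)
    then show "(\<Sum>k | k \<in> {1..n} \<and> k dvd j.
        parity_weight k * ((-1) ^ Suc (j div k) * int (p_d (n - j))))
      = int (p_d (n - j)) * signed_divisor_sum j"
      by (simp add: signed_divisor_sum_def sum_distrib_left mult_ac del: atLeastAtMost_iff)
  qed
  finally show ?thesis .
qed

text \<open>An odd divisor is coprime to the power of 2, so it divides \<open>u\<close>; an even one
  is twice a divisor of \<open>2 ^ a * u\<close>.\<close>

lemma sum_divisors_split_parity:
  fixes f :: "nat \<Rightarrow> int"
  assumes "odd u"
  shows "(\<Sum>d | d dvd 2 ^ Suc a * u. f d) = (\<Sum>d | d dvd u. f d) + (\<Sum>d | d dvd 2 ^ a * u. f (2 * d))"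
proof -
  let ?E = "{d. d dvd 2 ^ a * u}"
  have u: "u > 0" using assms by (auto intro: gr0I)
  have "{d. d dvd 2 ^ Suc a * u} = {d. d dvd u} \<union> (*) 2 ` ?E"
  proof (intro set_eqI iffI)
    fix d assume d: "d \<in> {d. d dvd 2 ^ Suc a * u}"
    show "d \<in> {d. d dvd u} \<union> (*) 2 ` ?E"
    proof (cases "even d")
      case True
      then show ?thesis using d by (auto simp: mult.assoc elim!: evenE)
    next
      case False
      then have "coprime d (2 ^ Suc a)" by simp
      then show ?thesis using d by (simp add: coprime_dvd_mult_right_iff)
    qed
  qed (auto simp: mult.assoc)
  moreover have "{d. d dvd u} \<inter> (*) 2 ` ?E = {}"
    using assms by auto
  ultimately have "(\<Sum>d | d dvd 2 ^ Suc a * u. f d) = (\<Sum>d | d dvd u. f d) + sum f ((*) 2 ` ?E)"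
    using u by (simp add: sum.union_disjoint)
  also have "sum f ((*) 2 ` ?E) = (\<Sum>d\<in>?E. f (2 * d))"
    by (simp add: sum.reindex inj_on_def)
  finally show ?thesis .
qed

lemma odd_div_dvd:
  fixes u d :: nat
  assumes "odd u" "d dvd u"
  shows "odd d" "odd (u div d)"
proof -
  have "u = d * (u div d)"
    using assms(2) by simp
  with assms(1) show "odd d" "odd (u div d)"
    by (metis even_mult_iff)+
qed

lemma even_div_odd_dvd:
  fixes u d :: nat
  assumes "odd u" "d dvd u"
  shows "even (2 ^ Suc a * u div d)"
  using assms by (simp add: div_mult_swap[symmetric] mult.assoc)

text \<open>In the induction step, odd divisors have even cofactors and give
  \<open>- sigma u\<close>. An even divisor \<open>2 * d\<close> has the cofactor of
  \<open>d\<close> in \<open>2 ^ a * u\<close>, so these give \<open>2 * sigma u\<close> by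
  induction.\<close>

lemma alternating_divisor_sum:
  assumes "odd u"
  shows "(\<Sum>d | d dvd 2 ^ a * u. int d * (-1) ^ Suc (2 ^ a * u div d)) = int (sigma u)"
proof (induction a)
  case 0
  show ?case
    using odd_div_dvd(2)[OF assms] by (simp add: sigma_def)
next
  case (Suc a)
  have "(\<Sum>d | d dvd u. int d * (-1) ^ Suc (2 ^ Suc a * u div d)) = - int (sigma u)"
    using even_div_odd_dvd[OF assms, of _ a] by (simp add: sigma_def sum_negf)
  moreover have "(\<Sum>d | d dvd 2 ^ a * u. int (2 * d) * (-1) ^ Suc (2 ^ Suc a * u div (2 * d)))
      = 2 * (\<Sum>d | d dvd 2 ^ a * u. int d * (-1) ^ Suc (2 ^ a * u div d))"
    by (simp add: sum_distrib_left mult.assoc sum_negf)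
  ultimately show ?case
    using Suc by (simp only: sum_divisors_split_parity[OF assms])
qed

text \<open>All divisors and cofactors are odd, so every sign is +.\<close>

lemma signed_divisor_sum_odd:
  assumes "odd j"
  shows "signed_divisor_sum j = int (sigma j)"
  using odd_div_dvd[OF assms] by (simp add: signed_divisor_sum_def parity_weight_def sigma_def)

text \<open>The odd divisors contribute \<open>- sigma u\<close>, the even ones -2 times the
  alternating sum, that is \<open>- 2 * sigma u\<close>.\<close>

lemma signed_divisor_sum_even:
  assumes "odd u"
  shows "signed_divisor_sum (2 ^ Suc a * u) = - 3 * int (sigma u)"
proof -
  have "(\<Sum>d | d dvd u. parity_weight d * (-1) ^ Suc (2 ^ Suc a * u div d)) = - int (sigma u)"
    using even_div_odd_dvd[OF assms, of _ a] odd_div_dvd(1)[OF assms]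
    by (simp add: sigma_def sum_negf parity_weight_def)
  moreover have "(\<Sum>d | d dvd 2 ^ a * u. parity_weight (2 * d) * (-1) ^ Suc (2 ^ Suc a * u div (2 * d)))
      = - 2 * (\<Sum>d | d dvd 2 ^ a * u. int d * (-1) ^ Suc (2 ^ a * u div d))"
    by (simp add: sum_distrib_left mult.assoc sum_negf parity_weight_def)
  ultimately show ?thesis
    unfolding signed_divisor_sum_def sum_divisors_split_parity[OF assms]
    using alternating_divisor_sum[OF assms, of a] by linarith
qed

lemma signed_divisor_sum_even_multiplicity:
  assumes "even j" "j > 0"
  shows "signed_divisor_sum j = - 3 * int (sigma (j div 2 ^ multiplicity 2 j))"
proof -
  obtain u where u: "j = 2 ^ multiplicity 2 j * u" "odd u"
    using multiplicity_decompose'[of j 2] assms by auto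
  \<comment> \<open>Evenness of \<open>j\<close> makes the exponent a successor, as the previous
    evaluation requires.\<close>
  have "multiplicity 2 j \<noteq> 0"
    using assms by (simp add: multiplicity_eq_zero_iff)
  then obtain a where a: "multiplicity 2 j = Suc a"
    using not0_implies_Suc by blast
  have ju: "j = 2 ^ Suc a * u"
    using u(1) unfolding a .
  then have "j div 2 ^ multiplicity 2 j = u"
    unfolding a by simp
  then show ?thesis
    using signed_divisor_sum_even[OF u(2), of a] ju by simp
qed

theorem theorem3p5:
  fixes n :: nat
  assumes "n \<ge> 1"
  shows "DSOME n =
    (\<Sum>j | 1 \<le> j \<and> j \<le> n \<and> odd j. int (p_d (n - j)) * int (sigma j))
    - 3 * (\<Sum>j | 1 \<le> j \<and> j \<le> n \<and> even j.
             int (p_d (n - j)) * int (sigma (j div 2 ^ multiplicity 2 j)))"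
proof -
  let ?O = "{j. 1 \<le> j \<and> j \<le> n \<and> odd j}" and ?E = "{j. 1 \<le> j \<and> j \<le> n \<and> even j}"
  let ?f = "\<lambda>j. int (p_d (n - j)) * signed_divisor_sum j"
  have "DSOME n = sum ?f (?O \<union> ?E)"
    unfolding DSOME_eq_convolution by (rule sum.cong) auto
  also have "\<dots> = sum ?f ?O + sum ?f ?E"
    by (rule sum.union_disjoint) auto
  also have "sum ?f ?O = (\<Sum>j\<in>?O. int (p_d (n - j)) * int (sigma j))"
    by (simp add: signed_divisor_sum_odd)
  also have "sum ?f ?E
      = - 3 * (\<Sum>j\<in>?E. int (p_d (n - j)) * int (sigma (j div 2 ^ multiplicity 2 j)))"
    unfolding sum_distrib_left
    by (intro sum.cong refl) (simp add: signed_divisor_sum_even_multiplicity)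
  finally show ?thesis by simp
qed

end
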